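(* There exists a one-to-one correspondence between the class of Lie algebras (resp. quadratic Lie algebras) admitting involutive automorphisms (resp. symmetric involutive automorphisms) and the class of Hom-Lie algebras (resp. quadratic Hom-Lie algebras) whose twist maps are involutive automorphisms (resp. symmetric involutive automorphisms).
   Context: $\mathbb K$ is an algebraically closed field of characteristic $0$; all algebras are over $\mathbb K$. A Hom-Lie algebra is a triple $(\mathfrak g,[\cdot,\cdot],\alpha)$ with $[\cdot,\cdot]$ a skew-symmetric bilinear bracket on the vector space $\mathfrak g$ and $\alpha:\mathfrak g\to\mathfrak g$ a linear map (the twist map) such that $[\alpha(x),[y,z]]+[\alpha(y),[z,x]]+[\alpha(z),[x,y]]=0$ for all $x,y,z$. A quadratic Hom-Lie algebra $(\mathfrak g,[\cdot,\cdot],\alpha,B)$ is a Hom-Lie algebra with a symmetric nondegenerate bilinear form $B$ such that $B([x,y],z)=B(x,[y,z])$ and $B(\alpha(x),y)=B(x,\alpha(y))$ for all $x,y,z$. A quadratic Lie algebra $(\mathfrak g,[\cdot,\cdot],B)$ is a Lie algebra with a symmetric nondegenerate bilinear form satisfying $B([x,y],z)=B(x,[y,z])$. An automorphism $\theta$ (a bijective linear map with $\theta([x,y])=[\theta(x),\theta(y)]$) is involutive if $\theta^2=\mathrm{id}$, and symmetric with respect to $B$ if $B(\theta(x),y)=B(x,\theta(y))$ for all $x,y$. *)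

theory Defs
  imports "HOL-Computational_Algebra.Polynomial"
begin

text \<open>
  Algebras live on a whole type \<open>'v\<close> of class ab_group_add; the vector space
  structure over the field \<open>'k\<close> is given by the scalar multiplication \<open>scale\<close>.
  No finiteness of the dimension is assumed.
\<close>

locale skew_algebra = vector_space scale
  for scale :: "'k::field \<Rightarrow> 'v::ab_group_add \<Rightarrow> 'v" +
  fixes bracket :: "'v \<Rightarrow> 'v \<Rightarrow> 'v"
  assumes linear_right: "Vector_Spaces.linear scale scale (bracket x)"
    and linear_left: "Vector_Spaces.linear scale scale (\<lambda>x. bracket x y)"
    and skew: "bracket x y = - bracket y x"

locale lie_algebra = skew_algebra scale bracket
  for scale :: "'k::field \<Rightarrow> 'v::ab_group_add \<Rightarrow> 'v" and bracket +
  assumes jacobi: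
    "bracket x (bracket y z) + bracket y (bracket z x) + bracket z (bracket x y) = 0"

locale hom_lie_algebra = skew_algebra scale bracket
  for scale :: "'k::field \<Rightarrow> 'v::ab_group_add \<Rightarrow> 'v" and bracket +
  fixes \<alpha> :: "'v \<Rightarrow> 'v"
  assumes linear_twist: "Vector_Spaces.linear scale scale \<alpha>"
    and hom_jacobi:
      "bracket (\<alpha> x) (bracket y z) + bracket (\<alpha> y) (bracket z x)
        + bracket (\<alpha> z) (bracket x y) = 0"

locale nondegenerate_symmetric_form = vector_space scale
  for scale :: "'k::field \<Rightarrow> 'v::ab_group_add \<Rightarrow> 'v" +
  fixes B :: "'v \<Rightarrow> 'v \<Rightarrow> 'k"
  assumes form_linear_right: "Vector_Spaces.linear scale (*) (B x)"
    and form_linear_left: "Vector_Spaces.linear scale (*) (\<lambda>x. B x y)"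
    and form_symmetric: "B x y = B y x"
    and form_nondegenerate: "(\<And>y. B x y = 0) \<Longrightarrow> x = 0"

locale quadratic_lie_algebra =
  lie_algebra scale bracket + nondegenerate_symmetric_form scale B
  for scale :: "'k::field \<Rightarrow> 'v::ab_group_add \<Rightarrow> 'v" and bracket B +
  assumes form_invariant: "B (bracket x y) z = B x (bracket y z)"

definition symmetric_map :: "('v \<Rightarrow> 'v \<Rightarrow> 'k) \<Rightarrow> ('v \<Rightarrow> 'v) \<Rightarrow> bool" where
  "symmetric_map B \<theta> \<longleftrightarrow> (\<forall>x y. B (\<theta> x) y = B x (\<theta> y))"

locale quadratic_hom_lie_algebra =
  hom_lie_algebra scale bracket \<alpha> + nondegenerate_symmetric_form scale B
  for scale :: "'k::field \<Rightarrow> 'v::ab_group_add \<Rightarrow> 'v" and bracket \<alpha> B +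
  assumes form_invariant: "B (bracket x y) z = B x (bracket y z)"
    and twist_symmetric: "symmetric_map B \<alpha>"

definition automorphism ::
  "('k::field \<Rightarrow> 'v::ab_group_add \<Rightarrow> 'v) \<Rightarrow> ('v \<Rightarrow> 'v \<Rightarrow> 'v) \<Rightarrow> ('v \<Rightarrow> 'v) \<Rightarrow> bool" where
  "automorphism scale bracket \<theta> \<longleftrightarrow>
    Vector_Spaces.linear scale scale \<theta> \<and> bij \<theta> \<and>
    (\<forall>x y. \<theta> (bracket x y) = bracket (\<theta> x) (\<theta> y))"

definition involutive_automorphism ::
  "('k::field \<Rightarrow> 'v::ab_group_add \<Rightarrow> 'v) \<Rightarrow> ('v \<Rightarrow> 'v \<Rightarrow> 'v) \<Rightarrow> ('v \<Rightarrow> 'v) \<Rightarrow> bool" where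
  "involutive_automorphism scale bracket \<theta> \<longleftrightarrow>
    automorphism scale bracket \<theta> \<and> \<theta> \<circ> \<theta> = id"

type_synonym ('k, 'v) algebra_with_map =
  "('k \<Rightarrow> 'v \<Rightarrow> 'v) \<times> ('v \<Rightarrow> 'v \<Rightarrow> 'v) \<times> ('v \<Rightarrow> 'v)"

type_synonym ('k, 'v) quadratic_algebra_with_map =
  "('k \<Rightarrow> 'v \<Rightarrow> 'v) \<times> ('v \<Rightarrow> 'v \<Rightarrow> 'v) \<times> ('v \<Rightarrow> 'v \<Rightarrow> 'k) \<times> ('v \<Rightarrow> 'v)"

text \<open>
  On the Lie side a member of the class is a Lie algebra together with a chosen
  (symmetric) involutive automorphism; on the Hom-Lie side the last component is
  the twist map.
\<close>

definition involutive_lie_algebras ::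
  "('k::field, 'v::ab_group_add) algebra_with_map set" where
  "involutive_lie_algebras = {(scale, bracket, \<theta>).
    lie_algebra scale bracket \<and> involutive_automorphism scale bracket \<theta>}"

definition involutive_hom_lie_algebras ::
  "('k::field, 'v::ab_group_add) algebra_with_map set" where
  "involutive_hom_lie_algebras = {(scale, bracket, \<alpha>).
    hom_lie_algebra scale bracket \<alpha> \<and> involutive_automorphism scale bracket \<alpha>}"

definition involutive_quadratic_lie_algebras ::
  "('k::field, 'v::ab_group_add) quadratic_algebra_with_map set" where
  "involutive_quadratic_lie_algebras = {(scale, bracket, B, \<theta>).
    quadratic_lie_algebra scale bracket B \<and>
    involutive_automorphism scale bracket \<theta> \<and> symmetric_map B \<theta>}"

definition involutive_quadratic_hom_lie_algebras ::
  "('k::field, 'v::ab_group_add) quadratic_algebra_with_map set" where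
  "involutive_quadratic_hom_lie_algebras = {(scale, bracket, B, \<alpha>).
    quadratic_hom_lie_algebra scale bracket \<alpha> B \<and>
    involutive_automorphism scale bracket \<alpha> \<and> symmetric_map B \<alpha>}"

text \<open>
  The correspondence keeps the vector space and the map \<open>\<theta>\<close>. It replaces the
  bracket by \<open>[x, y]\<^sub>\<theta> = \<theta>([x, y])\<close> and, in the quadratic case, the form by
  \<open>B\<^sub>\<theta>(x, y) = B(\<theta>(x), y)\<close>; the original \<open>B\<close> need not be invariant for the
  twisted bracket.
\<close>

definition twist :: "('k, 'v) algebra_with_map \<Rightarrow> ('k, 'v) algebra_with_map" where
  "twist = (\<lambda>(scale, bracket, \<theta>). (scale, \<lambda>x y. \<theta> (bracket x y), \<theta>))"

definition quadratic_twist ::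
  "('k, 'v) quadratic_algebra_with_map \<Rightarrow> ('k, 'v) quadratic_algebra_with_map" where
  "quadratic_twist = (\<lambda>(scale, bracket, B, \<theta>).
    (scale, \<lambda>x y. \<theta> (bracket x y), \<lambda>x y. B (\<theta> x) y, \<theta>))"

text \<open>
  Isomorphisms intertwine the distinguished maps: this is the usual notion for
  Hom-Lie algebras, and the evident one for Lie algebras with an automorphism.
\<close>

definition isomorphic ::
  "('k::field, 'v::ab_group_add) algebra_with_map \<Rightarrow>
   ('k, 'w::ab_group_add) algebra_with_map \<Rightarrow> bool" where
  "isomorphic = (\<lambda>(scale, bracket, \<theta>) (scale', bracket', \<theta>').
    \<exists>f. Vector_Spaces.linear scale scale' f \<and> bij f \<and>
      (\<forall>x y. f (bracket x y) = bracket' (f x) (f y)) \<and>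
      (\<forall>x. f (\<theta> x) = \<theta>' (f x)))"

definition quadratic_isomorphic ::
  "('k::field, 'v::ab_group_add) quadratic_algebra_with_map \<Rightarrow>
   ('k, 'w::ab_group_add) quadratic_algebra_with_map \<Rightarrow> bool" where
  "quadratic_isomorphic = (\<lambda>(scale, bracket, B, \<theta>) (scale', bracket', B', \<theta>').
    \<exists>f. Vector_Spaces.linear scale scale' f \<and> bij f \<and>
      (\<forall>x y. f (bracket x y) = bracket' (f x) (f y)) \<and>
      (\<forall>x y. B' (f x) (f y) = B x y) \<and>
      (\<forall>x. f (\<theta> x) = \<theta>' (f x)))"

end

theory Submission
  imports Defs
begin

text \<open>
  Since \<open>\<theta>\<close> is an involution commuting with the bracket, twisting twice by \<open>\<theta>\<close> gives
  back the original structure, and \<open>\<theta>[\<theta> x, \<theta>[y, z]] = [x, [y, z]]\<close> turns the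
  Hom-Jacobi identity of the twisted bracket into the Jacobi identity of the original one.
  Twisting the form once moves a \<open>\<theta>\<close> across \<open>B\<close>, which cancels the \<open>\<theta>\<close> in the twisted
  bracket. So both correspondences are involutions exchanging the two classes, and they
  are compatible with isomorphisms because isomorphisms intertwine the distinguished maps.
\<close>

lemma involutive_automorphismD:
  assumes "involutive_automorphism scale bracket \<theta>"
  shows "Vector_Spaces.linear scale scale \<theta>"
    and "\<theta> (bracket x y) = bracket (\<theta> x) (\<theta> y)"
    and "\<theta> (\<theta> x) = x"
  using assms
  by (auto simp: involutive_automorphism_def automorphism_def fun_eq_iff)

text \<open>Applying \<theta> to both sides of \<theta>[x, y] = [\<theta> x, \<theta> y] gives
  multiplicativity for the twisted bracket. So the twisted structure keeps its involution and can be
  twisted back.\<close>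

lemma involutive_automorphism_twist:
  assumes "involutive_automorphism scale bracket \<theta>"
  shows "involutive_automorphism scale (\<lambda>x y. \<theta> (bracket x y)) \<theta>"
  using assms by (simp add: involutive_automorphism_def automorphism_def)

lemma skew_algebra_twist:
  assumes "skew_algebra scale bracket" "Vector_Spaces.linear scale scale \<theta>"
  shows "skew_algebra scale (\<lambda>x y. \<theta> (bracket x y))"
proof -
  interpret skew_algebra scale bracket by fact
  interpret \<theta>: Vector_Spaces.linear scale scale \<theta> by fact
  show ?thesis
  proof (intro skew_algebra.intro skew_algebra_axioms.intro vector_space_axioms)
    fix x y
    show "Vector_Spaces.linear scale scale (\<lambda>y. \<theta> (bracket x y))"
      using Vector_Spaces.linear_compose[OF linear_right assms(2)] by (simp add: o_def)
    show "Vector_Spaces.linear scale scale (\<lambda>x. \<theta> (bracket x y))"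
      using Vector_Spaces.linear_compose[OF linear_left assms(2)] by (simp add: o_def)
    show "\<theta> (bracket x y) = - \<theta> (bracket y x)"
      by (metis skew \<theta>.neg)
  qed
qed

lemma hom_lie_algebra_twist:
  assumes "lie_algebra scale bracket" "involutive_automorphism scale bracket \<theta>"
  shows "hom_lie_algebra scale (\<lambda>x y. \<theta> (bracket x y)) \<theta>"
proof -
  interpret lie_algebra scale bracket by fact
  note \<theta> = involutive_automorphismD[OF assms(2)]
  show ?thesis
    by (intro hom_lie_algebra.intro hom_lie_algebra_axioms.intro
        skew_algebra_twist[OF skew_algebra_axioms \<theta>(1)] \<theta>(1))
      \<comment> \<open>Pushing \<theta> inward through both brackets puts exactly two copies of
        \<theta> on each of x, y and z. They cancel, and the Jacobi identity remains.\<close>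
      (simp add: \<theta>(2,3) jacobi)
qed

text \<open>Here \<theta>[x, \<theta>[y, z]] = [\<theta> x, \<theta> \<theta>[y, z]] = [\<theta> x,
  [y, z]], so the cyclic sum for the twisted bracket is the given Hom-Jacobi sum.\<close>

lemma lie_algebra_twist:
  assumes "hom_lie_algebra scale bracket \<theta>" "involutive_automorphism scale bracket \<theta>"
  shows "lie_algebra scale (\<lambda>x y. \<theta> (bracket x y))"
proof -
  interpret hom_lie_algebra scale bracket \<theta> by fact
  note \<theta> = involutive_automorphismD[OF assms(2)]
  show ?thesis
    by (intro lie_algebra.intro lie_algebra_axioms.intro
        skew_algebra_twist[OF skew_algebra_axioms \<theta>(1)])
      (use hom_jacobi in \<open>simp add: \<theta>(2,3)\<close>)
qed

lemma nondegenerate_symmetric_form_twist: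
  assumes "nondegenerate_symmetric_form scale B" "Vector_Spaces.linear scale scale \<theta>"
    and invol: "\<And>x. \<theta> (\<theta> x) = x" and sym: "symmetric_map B \<theta>"
  shows "nondegenerate_symmetric_form scale (\<lambda>x y. B (\<theta> x) y)"
proof -
  interpret nondegenerate_symmetric_form scale B by fact
  interpret \<theta>: Vector_Spaces.linear scale scale \<theta> by fact
  show ?thesis
  proof (intro nondegenerate_symmetric_form.intro
      nondegenerate_symmetric_form_axioms.intro vector_space_axioms)
    fix x y
    show "Vector_Spaces.linear scale (*) (B (\<theta> x))"
      by (rule form_linear_right)
    show "Vector_Spaces.linear scale (*) (\<lambda>x. B (\<theta> x) y)"
      using Vector_Spaces.linear_compose[OF assms(2) form_linear_left] by (simp add: o_def)
    \<comment> \<open>Self-adjointness of \<theta> is what makes the twisted form symmetric: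
      B(\<theta> x, y) = B(x, \<theta> y) = B(\<theta> y, x).\<close>
    show "B (\<theta> x) y = B (\<theta> y) x"
      using sym by (metis form_symmetric symmetric_map_def)
  next
    fix x
    assume "\<And>y. B (\<theta> x) y = 0"
    then have "\<theta> x = 0" by (rule form_nondegenerate)
    then show "x = 0" by (metis invol \<theta>.zero)
  qed
qed

lemma symmetric_map_twist:
  assumes "symmetric_map B \<theta>"
  shows "symmetric_map (\<lambda>x y. B (\<theta> x) y) \<theta>"
  using assms by (simp add: symmetric_map_def)

text \<open>Both sides reduce to the invariance of B: the left one is B([x, y], z), and moving
  \<theta> across B turns the right one into B(x, [y, z]). No Jacobi-type identity enters, so one
  lemma serves both directions of the correspondence.\<close>

lemma form_invariant_twist:
  assumes "involutive_automorphism scale bracket \<theta>" "symmetric_map B \<theta>"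
    and "\<And>x y z. B (bracket x y) z = B x (bracket y z)"
  shows "B (\<theta> (\<theta> (bracket x y))) z = B (\<theta> x) (\<theta> (bracket y z))"
  using assms(2,3) involutive_automorphismD(3)[OF assms(1)]
  by (metis symmetric_map_def)

lemma quadratic_hom_lie_algebra_twist:
  assumes "quadratic_lie_algebra scale bracket B"
    and "involutive_automorphism scale bracket \<theta>" "symmetric_map B \<theta>"
  shows "quadratic_hom_lie_algebra scale (\<lambda>x y. \<theta> (bracket x y)) \<theta> (\<lambda>x y. B (\<theta> x) y)"
proof -
  interpret quadratic_lie_algebra scale bracket B by fact
  note \<theta> = involutive_automorphismD[OF assms(2)]
  show ?thesis
    by (intro quadratic_hom_lie_algebra.intro quadratic_hom_lie_algebra_axioms.intro
        hom_lie_algebra_twist[OF lie_algebra_axioms assms(2)]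
        nondegenerate_symmetric_form_twist[OF nondegenerate_symmetric_form_axioms
          \<theta>(1,3) assms(3)]
        symmetric_map_twist[OF assms(3)]
        form_invariant_twist[OF assms(2,3) form_invariant])
qed

lemma quadratic_lie_algebra_twist:
  assumes "quadratic_hom_lie_algebra scale bracket \<theta> B"
    and "involutive_automorphism scale bracket \<theta>" "symmetric_map B \<theta>"
  shows "quadratic_lie_algebra scale (\<lambda>x y. \<theta> (bracket x y)) (\<lambda>x y. B (\<theta> x) y)"
proof -
  interpret quadratic_hom_lie_algebra scale bracket \<theta> B by fact
  note \<theta> = involutive_automorphismD[OF assms(2)]
  show ?thesis
    by (intro quadratic_lie_algebra.intro quadratic_lie_algebra_axioms.intro
        lie_algebra_twist[OF hom_lie_algebra_axioms assms(2)]
        nondegenerate_symmetric_form_twist[OF nondegenerate_symmetric_form_axioms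
          \<theta>(1,3) assms(3)]
        form_invariant_twist[OF assms(2,3) form_invariant])
qed

text \<open>The union of the two classes appears because \<open>twist\<close> is its own inverse:
  \<open>bij_betw_byWitness\<close> asks for the cancellation once on each class.\<close>

lemma twist_twist:
  assumes "A \<in> involutive_lie_algebras \<union> involutive_hom_lie_algebras"
  shows "twist (twist A) = A"
  using assms
  by (auto simp: twist_def involutive_lie_algebras_def involutive_hom_lie_algebras_def
      involutive_automorphismD(3))

lemma quadratic_twist_twist:
  assumes "A \<in> involutive_quadratic_lie_algebras \<union> involutive_quadratic_hom_lie_algebras"
  shows "quadratic_twist (quadratic_twist A) = A"
  using assms
  by (auto simp: quadratic_twist_def involutive_quadratic_lie_algebras_def
      involutive_quadratic_hom_lie_algebras_def involutive_automorphismD(3))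

lemma bij_betw_twist: "bij_betw twist involutive_lie_algebras involutive_hom_lie_algebras"
proof (rule bij_betw_byWitness[where f' = twist])
  show "twist ` involutive_lie_algebras \<subseteq> involutive_hom_lie_algebras"
    by (auto simp: twist_def involutive_lie_algebras_def involutive_hom_lie_algebras_def
        intro: hom_lie_algebra_twist involutive_automorphism_twist)
  show "twist ` involutive_hom_lie_algebras \<subseteq> involutive_lie_algebras"
    by (auto simp: twist_def involutive_lie_algebras_def involutive_hom_lie_algebras_def
        intro: lie_algebra_twist involutive_automorphism_twist)
qed (simp_all add: twist_twist)

lemma bij_betw_quadratic_twist:
  "bij_betw quadratic_twist involutive_quadratic_lie_algebras
    involutive_quadratic_hom_lie_algebras"
proof (rule bij_betw_byWitness[where f' = quadratic_twist])
  show "quadratic_twist ` involutive_quadratic_lie_algebras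
      \<subseteq> involutive_quadratic_hom_lie_algebras"
    by (auto simp: quadratic_twist_def involutive_quadratic_lie_algebras_def
        involutive_quadratic_hom_lie_algebras_def
        intro: quadratic_hom_lie_algebra_twist involutive_automorphism_twist symmetric_map_twist)
  show "quadratic_twist ` involutive_quadratic_hom_lie_algebras
      \<subseteq> involutive_quadratic_lie_algebras"
    by (auto simp: quadratic_twist_def involutive_quadratic_lie_algebras_def
        involutive_quadratic_hom_lie_algebras_def
        intro: quadratic_lie_algebra_twist involutive_automorphism_twist symmetric_map_twist)
qed (simp_all add: quadratic_twist_twist)

text \<open>The same f works: f(\<theta>[x, y]) = \<theta>'(f[x, y]) = \<theta>'[f x, f y]', where
  the first equality is the intertwining condition.\<close>

lemma isomorphic_twist: "isomorphic A A' \<Longrightarrow> isomorphic (twist A) (twist A')"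
  by (cases A; cases A') (auto simp: isomorphic_def twist_def)

lemma quadratic_isomorphic_twist:
  assumes "quadratic_isomorphic A A'"
  shows "quadratic_isomorphic (quadratic_twist A) (quadratic_twist A')"
proof -
  obtain scale bracket B \<theta> scale' bracket' B' \<theta>'
    where A: "A = (scale, bracket, B, \<theta>)" "A' = (scale', bracket', B', \<theta>')"
    by (metis prod_cases4)
  with assms obtain f where "Vector_Spaces.linear scale scale' f" "bij f"
    "\<And>x y. f (bracket x y) = bracket' (f x) (f y)"
    and form: "\<And>x y. B' (f x) (f y) = B x y"
    and commute: "\<And>x. f (\<theta> x) = \<theta>' (f x)"
    by (auto simp: quadratic_isomorphic_def)
  \<comment> \<open>Intertwining rewrites \<theta>'(f x) as f(\<theta> x), so f being an isometry
    for the original forms makes it one for the twisted forms.\<close>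
  moreover have "B' (\<theta>' (f x)) (f y) = B (\<theta> x) y" for x y
    by (metis form commute)
  ultimately show ?thesis
    by (auto simp: A quadratic_isomorphic_def quadratic_twist_def)
qed

theorem theorem5p1:
  shows "bij_betw twist
      (involutive_lie_algebras ::
        ('k::{alg_closed_field, field_char_0}, 'v::ab_group_add) algebra_with_map set)
      involutive_hom_lie_algebras
    \<and> (\<forall>A \<in> (involutive_lie_algebras :: ('k, 'v) algebra_with_map set).
        \<forall>A' \<in> (involutive_lie_algebras :: ('k, 'w::ab_group_add) algebra_with_map set).
          isomorphic (twist A) (twist A') \<longleftrightarrow> isomorphic A A')
    \<and> bij_betw quadratic_twist
      (involutive_quadratic_lie_algebras :: ('k, 'v) quadratic_algebra_with_map set)
      involutive_quadratic_hom_lie_algebras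
    \<and> (\<forall>A \<in> (involutive_quadratic_lie_algebras :: ('k, 'v) quadratic_algebra_with_map set).
        \<forall>A' \<in> (involutive_quadratic_lie_algebras :: ('k, 'w) quadratic_algebra_with_map set).
          quadratic_isomorphic (quadratic_twist A) (quadratic_twist A') \<longleftrightarrow>
          quadratic_isomorphic A A')"
proof (intro conjI ballI)
  show "isomorphic (twist A) (twist A') \<longleftrightarrow> isomorphic A A'"
    if "A \<in> involutive_lie_algebras" "A' \<in> involutive_lie_algebras"
    for A :: "('k, 'v) algebra_with_map" and A' :: "('k, 'w) algebra_with_map"
    \<comment> \<open>The second instance gives the forward implication: an isomorphism of the
      twisted algebras is also one of their twists, which are A and A' again.\<close>
    using that isomorphic_twist[of A A'] isomorphic_twist[of "twist A" "twist A'"]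
    by (auto simp: twist_twist)
  show "quadratic_isomorphic (quadratic_twist A) (quadratic_twist A') \<longleftrightarrow>
      quadratic_isomorphic A A'"
    if "A \<in> involutive_quadratic_lie_algebras" "A' \<in> involutive_quadratic_lie_algebras"
    for A :: "('k, 'v) quadratic_algebra_with_map"
      and A' :: "('k, 'w) quadratic_algebra_with_map"
    using that quadratic_isomorphic_twist[of A A']
      quadratic_isomorphic_twist[of "quadratic_twist A" "quadratic_twist A'"]
    by (auto simp: quadratic_twist_twist)
qed (fact bij_betw_twist bij_betw_quadratic_twist)+

end
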